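(* Let $s>625$ be an integer. Every $3$-uniform $[1,s]$-almost intersecting hypergraph has at most $6s+6$ edges. The only such hypergraphs with exactly $6s+6$ edges are those of the form $\mathcal{M}_f$: here $A,B$ are disjoint sets with $|A|=4$ and $|B|\ge s+1$, $f:\binom{A}{2}\to\binom{B}{s+1}$ satisfies $f(S)=f(A\setminus S)$ for all $S\in\binom{A}{2}$, and $\mathcal{M}_f=\{S\cup\{x\}: S\in\binom{A}{2},\ x\in f(S)\}$.
   Context: A $3$-uniform hypergraph is a finite set of distinct $3$-element sets. It is $[1,s]$-almost intersecting if every edge is disjoint from at least $1$ and at most $s$ edges of the hypergraph. $\binom{S}{j}$ denotes the family of $j$-element subsets of $S$. *)

theory Defs
  imports "HOL-Library.Ramsey" "HOL-Library.FuncSet"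
begin

text \<open>\<open>nsets S j\<close> is the family of (finite) \<open>j\<close>-element subsets of \<open>S\<close>.\<close>

definition uniform_hypergraph :: "nat \<Rightarrow> 'a set set \<Rightarrow> bool" where
  "uniform_hypergraph k H \<longleftrightarrow> finite H \<and> H \<subseteq> nsets UNIV k"

definition almost_intersecting :: "nat \<Rightarrow> nat \<Rightarrow> 'a set set \<Rightarrow> bool" where
  "almost_intersecting a b H \<longleftrightarrow>
     (\<forall>e\<in>H. a \<le> card {e'\<in>H. disjnt e e'} \<and> card {e'\<in>H. disjnt e e'} \<le> b)"

text \<open>Only the values of \<open>f\<close> on the two-element subsets of \<open>A\<close> are relevant below.\<close>

definition M_hypergraph :: "'a set \<Rightarrow> ('a set \<Rightarrow> 'a set) \<Rightarrow> 'a set set" where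
  "M_hypergraph A f = {S \<union> {x} | S x. S \<in> nsets A 2 \<and> x \<in> f S}"

text \<open>The set \<open>B\<close> may be infinite, in which case \<^term>\<open>card B = 0\<close>; hence the separate disjunct
  for \<open>|B| \<ge> s + 1\<close>.\<close>

definition M_data :: "nat \<Rightarrow> 'a set \<Rightarrow> 'a set \<Rightarrow> ('a set \<Rightarrow> 'a set) \<Rightarrow> bool" where
  "M_data s A B f \<longleftrightarrow>
     disjnt A B \<and> card A = 4 \<and> (infinite B \<or> s + 1 \<le> card B) \<and>
     f \<in> nsets A 2 \<rightarrow> nsets B (s + 1) \<and>
     (\<forall>S\<in>nsets A 2. f S = f (A - S))"

end

theory Submission
  imports Defs
begin

text \<open>Call a pair heavy if at least 100 edges contain it. An edge disjoint from a pair meets at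
  most three of the edges through it, so a pair has degree at most \<open>s + 3\<close>, and double counting
  disjoint pairs of edges shows that a heavy pair is missed by at most \<open>100 s / 97\<close> edges. If there
  are at least \<open>6 s + 6\<close> edges, then at least \<open>4 s + 6\<close> of them meet both members of a disjoint
  pair of edges, which yields two disjoint heavy pairs. All but about \<open>2 s\<close> edges meet both of
  these, so the four cross pairs have degree close to \<open>s\<close>, and so, repeating the argument, do
  all pairs inside the resulting 4-set \<open>A\<close>. An edge with at most one vertex in \<open>A\<close> would now miss
  too many edges, and a triple inside \<open>A\<close> would miss none. So every edge is a pair of \<open>A\<close> plus an
  outer vertex, and comparing complementary pairs of \<open>A\<close> finishes the proof.\<close>

section \<open>Degrees of pairs and edges missing a pair\<close>

locale almost_intersecting_triples =
  fixes H :: "'a set set" and s :: nat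
  assumes uniform: "uniform_hypergraph 3 H"
    and almost: "almost_intersecting 1 s H"
begin

definition star :: "'a set \<Rightarrow> 'a set set" where
  "star p = {e \<in> H. p \<subseteq> e}"

text \<open>Applied to pairs and to edges alike; for an edge it is the family whose size lies
  between 1 and \<open>s\<close>.\<close>

definition missing :: "'a set \<Rightarrow> 'a set set" where
  "missing p = {e \<in> H. disjnt p e}"

lemma finite_H [simp]: "finite H"
  using uniform by (simp add: uniform_hypergraph_def)

lemma finite_star [simp]: "finite (star p)"
  by (simp add: star_def)

lemma finite_missing [simp]: "finite (missing p)"
  by (simp add: missing_def)

lemma card_edge: "e \<in> H \<Longrightarrow> card e = 3"
  using uniform by (auto simp: uniform_hypergraph_def nsets_def)

lemma finite_edge: "e \<in> H \<Longrightarrow> finite e"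
  using uniform by (auto simp: uniform_hypergraph_def nsets_def)

lemma card_missing_edge_le: "e \<in> H \<Longrightarrow> card (missing e) \<le> s"
  using almost by (auto simp: almost_intersecting_def missing_def)

lemma disjoint_edge_exists:
  assumes "e \<in> H"
  obtains e' where "e' \<in> H" "disjnt e e'"
proof -
  have "card {e'\<in>H. disjnt e e'} \<noteq> 0"
    using almost assms by (force simp: almost_intersecting_def)
  then have "{e'\<in>H. disjnt e e'} \<noteq> {}"
    by (metis card.empty)
  then show thesis using that by blast
qed

text \<open>As \<open>e\<close> avoids \<open>p\<close>, an edge through \<open>p\<close> can meet
  \<open>e\<close> only in its third vertex, so it is \<open>p\<close> plus one of the three
  vertices of \<open>e\<close>.\<close>

lemma card_star_le_missing:
  assumes e: "e \<in> H" and p: "card p = 2" and dis: "disjnt e p"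
  shows "card (star p) \<le> card (star p \<inter> missing e) + 3"
proof -
  have "star p - missing e \<subseteq> (\<lambda>z. insert z p) ` e"
  proof
    fix f assume "f \<in> star p - missing e"
    then have f: "f \<in> H" "p \<subseteq> f" "\<not> disjnt e f"
      by (auto simp: star_def missing_def)
    then obtain z where z: "z \<in> e" "z \<in> f" by (auto simp: disjnt_iff)
    then have "z \<notin> p" using dis by (auto simp: disjnt_iff)
    moreover have "finite p" using p card.infinite by force
    ultimately have "card (insert z p) = card f" using p card_edge[OF f(1)] by simp
    then have "insert z p = f"
      using f z by (intro card_subset_eq) (auto simp: finite_edge)
    then show "f \<in> (\<lambda>z. insert z p) ` e" using z by blast
  qed
  then have "card (star p - missing e) \<le> 3"
    using surj_card_le[OF finite_edge[OF e]] card_edge[OF e] by metis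
  moreover have "card (star p) \<le> card (star p \<inter> missing e) + card (star p - missing e)"
    by (metis Int_Diff_Un card_Un_le)
  ultimately show ?thesis by linarith
qed

lemma card_star_le:
  assumes "card p = 2"
  shows "card (star p) \<le> s + 3"
proof (cases "star p = {}")
  case False
  then obtain e where e: "e \<in> H" "p \<subseteq> e" by (auto simp: star_def)
  obtain e' where e': "e' \<in> H" "disjnt e e'" using disjoint_edge_exists e by blast
  then have "disjnt e' p" using e by (auto simp: disjnt_iff)
  then have "card (star p) \<le> card (star p \<inter> missing e') + 3"
    using card_star_le_missing e' assms by blast
  also have "card (star p \<inter> missing e') \<le> card (missing e')" by (intro card_mono) auto
  also have "\<dots> \<le> s" using card_missing_edge_le e' by blast
  finally show ?thesis by simp
qed simp

text \<open>Double counting of the disjoint pairs of an edge in \<open>missing p\<close> and one in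
  \<open>star p\<close>: each edge missing \<open>p\<close> is disjoint from all but three members
  of \<open>star p\<close>, while each member of \<open>star p\<close> is disjoint from at most
  \<open>s\<close> edges.\<close>

lemma missing_times_star_le:
  assumes p: "card p = 2"
  shows "card (missing p) * (card (star p) - 3) \<le> s * card (star p)"
proof -
  have "card (missing p) * (card (star p) - 3) \<le> (\<Sum>e\<in>missing p. card (star p \<inter> missing e))"
  proof -
    have "(\<Sum>e\<in>missing p. card (star p) - 3) \<le> (\<Sum>e\<in>missing p. card (star p \<inter> missing e))"
    proof (rule sum_mono)
      fix e assume "e \<in> missing p"
      then have "e \<in> H" "disjnt e p" by (auto simp: missing_def disjnt_sym)
      from card_star_le_missing[OF this(1) p this(2)]
      show "card (star p) - 3 \<le> card (star p \<inter> missing e)" by simp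
    qed
    then show ?thesis by simp
  qed
  also have "\<dots> = (\<Sum>e\<in>missing p. \<Sum>f\<in>star p. if disjnt e f then 1 else 0)"
  proof (rule sum.cong[OF refl])
    fix e
    have "star p \<inter> missing e = {f \<in> star p. disjnt e f}" by (auto simp: star_def missing_def)
    then show "card (star p \<inter> missing e) = (\<Sum>f\<in>star p. if disjnt e f then 1 else 0)"
      by (simp flip: sum.inter_filter)
  qed
  also have "\<dots> = (\<Sum>f\<in>star p. \<Sum>e\<in>missing p. if disjnt e f then 1 else 0)"
    by (rule sum.swap)
  also have "\<dots> = (\<Sum>f\<in>star p. card {e \<in> missing p. disjnt e f})"
    by (simp flip: sum.inter_filter)
  also have "\<dots> \<le> (\<Sum>f\<in>star p. s)"
  proof (rule sum_mono)
    fix f assume "f \<in> star p"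
    then have "f \<in> H" by (simp add: star_def)
    have "card {e \<in> missing p. disjnt e f} \<le> card (missing f)"
      by (intro card_mono) (auto simp: missing_def disjnt_sym)
    with card_missing_edge_le[OF \<open>f \<in> H\<close>]
    show "card {e \<in> missing p. disjnt e f} \<le> s" by linarith
  qed
  finally show ?thesis by (simp add: mult.commute)
qed

text \<open>The ratio \<open>t / (t - 3)\<close> decreases in \<open>t\<close> and equals
  \<open>100 / 97\<close> at the threshold degree 100.\<close>

lemma heavy_missing_le:
  assumes p: "card p = 2" and heavy: "100 \<le> card (star p)"
  shows "97 * card (missing p) \<le> 100 * s"
proof -
  obtain d where d: "card (star p) = d + 3" "97 \<le> d"
    using heavy that[of "card (star p) - 3"] by simp
  have "(97 * card (missing p)) * d \<le> 97 * (s * (d + 3))"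
    using missing_times_star_le[OF p] d by simp
  also have "\<dots> = s * (97 * d + 291)" by (simp add: algebra_simps)
  also have "\<dots> \<le> s * (100 * d)" using d by (intro mult_left_mono) auto
  finally have "(97 * card (missing p)) * d \<le> (100 * s) * d" by (simp add: algebra_simps)
  then show ?thesis using d by simp
qed

text \<open>Union bound: an edge that misses neither \<open>p\<close> nor \<open>q\<close> contains
  some \<open>{x, y}\<close> with \<open>x\<close> in \<open>p\<close> and \<open>y\<close> in
  \<open>q\<close>.\<close>

lemma card_H_le_cross:
  assumes "finite p" "finite q"
  shows "card H \<le> card (missing p) + card (missing q) + (\<Sum>x\<in>p. \<Sum>y\<in>q. card (star {x,y}))"
proof -
  have "H \<subseteq> missing p \<union> missing q \<union> (\<Union>x\<in>p. \<Union>y\<in>q. star {x,y})"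
    by (auto simp: missing_def star_def disjnt_iff)
  then have "card H \<le> card (missing p \<union> missing q \<union> (\<Union>x\<in>p. \<Union>y\<in>q. star {x,y}))"
    using assms by (intro card_mono) auto
  also have "\<dots> \<le> card (missing p) + card (missing q) + card (\<Union>x\<in>p. \<Union>y\<in>q. star {x,y})"
    by (meson add_le_mono card_Un_le le_refl le_trans)
  also have "card (\<Union>x\<in>p. \<Union>y\<in>q. star {x,y}) \<le> (\<Sum>x\<in>p. \<Sum>y\<in>q. card (star {x,y}))"
    using assms by (intro order.trans[OF card_UN_le sum_mono] card_UN_le) auto
  finally show ?thesis by simp
qed

end

section \<open>Four vertices whose pairs all have large degree\<close>

locale large_almost_intersecting_triples = almost_intersecting_triples +
  assumes s_gt: "625 < s" and large: "6 * s + 6 \<le> card H"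
begin

lemma disjoint_heavy_pairs:
  obtains a b c d where "distinct [a, b, c, d]"
    "100 \<le> card (star {a, b})" "100 \<le> card (star {c, d})"
proof -
  have "H \<noteq> {}" using large by auto
  then obtain e e' where e: "e \<in> H" "e' \<in> H" "disjnt e e'"
    using disjoint_edge_exists by blast
  obtain a b c where abc: "e = {a,b,c}" "distinct [a,b,c]"
    using card_edge[OF e(1)] by (auto simp: card_3_iff)
  obtain u v w where uvw: "e' = {u,v,w}" "distinct [u,v,w]"
    using card_edge[OF e(2)] by (auto simp: card_3_iff)
  have dist: "distinct [a,b,c,u,v,w]" using abc uvw e(3) by (auto simp: disjnt_iff)
  define d where "d x y = card (star {x,y})" for x y
  have d_le: "d x y \<le> s + 3" if "x \<noteq> y" for x y
    using that by (simp add: d_def card_star_le)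
  have "card H \<le> s + s + (\<Sum>x\<in>e. \<Sum>y\<in>e'. d x y)"
    using card_H_le_cross[of e e'] card_missing_edge_le[of e] card_missing_edge_le[of e'] e
      finite_edge by (fastforce simp: d_def)
  then have tot: "4 * s + 6 \<le>
      (d a u + d b v + d c w) + (d a v + d b w + d c u) + (d a w + d b u + d c v)"
    using large dist by (simp add: abc(1) uvw(1))
  \<comment> \<open>The nine cross pairs form three perfect matchings, so one matching has total degree above
    \<open>s + 201\<close>; by \<open>d_le\<close> two of its pairs are heavy.\<close>
  have "\<exists>x y z t. distinct [x, y, z, t] \<and> 100 \<le> d x y \<and> 100 \<le> d z t"
  proof (rule ccontr)
    assume neg: "\<not> ?thesis"
    \<comment> \<open>With at most one heavy pair among three disjoint ones, the sum is at most
      \<open>(s + 3) + 99 + 99\<close>.\<close>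
    have *: "d x y + d z t + d p q \<le> s + 201" if "distinct [x,y,z,t,p,q]" for x y z t p q
    proof -
      have "d x y < 100 \<or> d z t < 100" "d x y < 100 \<or> d p q < 100" "d z t < 100 \<or> d p q < 100"
        using neg that by (auto simp: not_le)
      moreover have "d x y \<le> s + 3" "d z t \<le> s + 3" "d p q \<le> s + 3"
        using d_le that by auto
      ultimately show ?thesis by linarith
    qed
    have "d a u + d b v + d c w \<le> s + 201" "d a v + d b w + d c u \<le> s + 201"
      "d a w + d b u + d c v \<le> s + 201"
      using dist by (auto intro!: *)
    \<comment> \<open>Otherwise \<open>4 * s + 6 \<le> 3 * (s + 201)\<close>, that is,
      \<open>s \<le> 597\<close>.\<close>
    then show False using tot s_gt by linarith
  qed
  then show thesis using that by (auto simp: d_def)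
qed

text \<open>Of the \<open>6 * s + 6\<close> edges, at most \<open>200 * s / 97\<close> miss one of
  the two heavy pairs, and the other three cross pairs account for at most
  \<open>3 * (s + 3)\<close>. This leaves at least \<open>91 * s / 97 - 3\<close> for
  \<open>{a, c}\<close>.\<close>

lemma heavy_cross_pair:
  assumes dist: "distinct [a, b, c, d]"
    and "100 \<le> card (star {a, b})" "100 \<le> card (star {c, d})"
  shows "91 * s \<le> 97 * card (star {a, c}) + 291"
proof -
  have "97 * card (missing {a,b}) \<le> 100 * s" "97 * card (missing {c,d}) \<le> 100 * s"
    using assms by (auto intro!: heavy_missing_le)
  moreover have "card (star {a,d}) \<le> s + 3" "card (star {b,c}) \<le> s + 3" "card (star {b,d}) \<le> s + 3"
    using dist by (auto intro!: card_star_le)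
  moreover have "card H \<le> card (missing {a,b}) + card (missing {c,d}) +
      (card (star {a,c}) + card (star {a,d}) + (card (star {b,c}) + card (star {b,d})))"
    using card_H_le_cross[of "{a,b}" "{c,d}"] dist by simp
  ultimately show ?thesis using large by linarith
qed

lemma heavy_quadruple:
  obtains A where "card A = 4" "\<And>p. p \<in> nsets A 2 \<Longrightarrow> 91 * s \<le> 97 * card (star p) + 291"
proof -
  obtain a b c d where D: "distinct [a, b, c, d]"
    and h: "100 \<le> card (star {a, b})" "100 \<le> card (star {c, d})"
    using disjoint_heavy_pairs by blast
  have up: "100 \<le> n" if "91 * s \<le> 97 * n + 291" for n using that s_gt by linarith
  have ac: "91 * s \<le> 97 * card (star {a, c}) + 291" using heavy_cross_pair D h by blast
  have ad: "91 * s \<le> 97 * card (star {a, d}) + 291"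
    using heavy_cross_pair[of a b d c] D h by (auto simp: insert_commute)
  have bc: "91 * s \<le> 97 * card (star {b, c}) + 291"
    using heavy_cross_pair[of b a c d] D h by (auto simp: insert_commute)
  have bd: "91 * s \<le> 97 * card (star {b, d}) + 291"
    using heavy_cross_pair[of b a d c] D h by (auto simp: insert_commute)
  \<comment> \<open>The pairs \<open>{a, c}\<close> and \<open>{b, d}\<close> are now known to be
    heavy and disjoint, and \<open>{a, b}\<close> and \<open>{c, d}\<close> are cross pairs between
    them.\<close>
  have ab: "91 * s \<le> 97 * card (star {a, b}) + 291"
    using heavy_cross_pair[of a c b d] D up[OF ac] up[OF bd] by auto
  have cd: "91 * s \<le> 97 * card (star {c, d}) + 291"
    using heavy_cross_pair[of c a d b] D up[OF ac] up[OF bd] by (auto simp: insert_commute)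
  show thesis
  proof
    show "card {a,b,c,d} = 4" using D by simp
    fix p assume "p \<in> nsets {a,b,c,d} 2"
    then obtain x y where "p = {x,y}" "x \<noteq> y" "x \<in> {a,b,c,d}" "y \<in> {a,b,c,d}"
      by (auto simp: nsets_def card_2_iff)
    then show "91 * s \<le> 97 * card (star p) + 291"
      using ab ac ad bc bd cd by (auto simp: insert_commute)
  qed
qed

text \<open>An edge with at most one vertex in \<open>A\<close> leaves three vertices
  \<open>x\<close>, \<open>y\<close>, \<open>z\<close> of \<open>A\<close> uncovered. All but three
  edges of each of the stars of \<open>{x, y}\<close> and \<open>{x, z}\<close> miss it, and these
  stars share at most the edge \<open>{x, y, z}\<close>, so the edge misses nearly
  \<open>2 * s\<close> others.\<close>

lemma edge_meets_quadruple:
  assumes A: "card A = 4" and heavy: "\<And>p. p \<in> nsets A 2 \<Longrightarrow> 91 * s \<le> 97 * card (star p) + 291"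
    and e: "e \<in> H"
  shows "2 \<le> card (e \<inter> A)"
proof (rule ccontr)
  assume "\<not> ?thesis"
  moreover have finA: "finite A" using A card.infinite by force
  ultimately have "3 \<le> card (A - e)"
    using A card_Diff_subset_Int[of A e] by (simp add: Int_commute)
  then obtain T where T: "T \<subseteq> A - e" "card T = 3" by (meson obtain_subset_with_card_n)
  then obtain x y z where xyz: "T = {x,y,z}" "distinct [x,y,z]" by (auto simp: card_3_iff)
  define P where "P = star {x,y} \<inter> missing e"
  define Q where "Q = star {x,z} \<inter> missing e"
  have "disjnt e {x,y}" "disjnt e {x,z}" using T xyz by (auto simp: disjnt_iff)
  then have PQ: "card (star {x,y}) \<le> card P + 3" "card (star {x,z}) \<le> card Q + 3"
    using card_star_le_missing[OF e] xyz by (auto simp: P_def Q_def)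
  have "{x,y} \<in> nsets A 2" "{x,z} \<in> nsets A 2" using T xyz by (auto simp: nsets_def)
  note h = this[THEN heavy]
  have "P \<inter> Q \<subseteq> {T}"
  proof
    fix f assume "f \<in> P \<inter> Q"
    then have "f \<in> H" "T \<subseteq> f" using xyz by (auto simp: P_def Q_def star_def)
    then have "T = f" using card_subset_eq[of f T] T card_edge[of f] finite_edge by auto
    then show "f \<in> {T}" by simp
  qed
  then have "card (P \<inter> Q) \<le> 1" using card_mono[of "{T}"] by fastforce
  moreover have "card P + card Q = card (P \<union> Q) + card (P \<inter> Q)"
    by (rule card_Un_Int) (auto simp: P_def Q_def)
  moreover have "card (P \<union> Q) \<le> card (missing e)"
    by (intro card_mono) (auto simp: P_def Q_def)
  \<comment> \<open>The bounds combine to \<open>2 * (91 * s / 97 - 6) \<le> s + 1\<close>, which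
    fails once \<open>s > 14\<close>.\<close>
  ultimately show False using card_missing_edge_le[OF e] PQ h s_gt by linarith
qed

end

section \<open>Counting edges and disjoint edges in \<open>M_hypergraph A f\<close>\<close>

lemma M_hypergraph_image:
  "M_hypergraph A f = (\<lambda>(S, x). insert x S) ` Sigma (nsets A 2) f"
  by (auto simp: M_hypergraph_def image_iff)

lemma mem_M_hypergraph:
  "e \<in> M_hypergraph A f \<longleftrightarrow> (\<exists>S\<in>nsets A 2. \<exists>x\<in>f S. e = insert x S)"
  by (auto simp: M_hypergraph_def)

text \<open>No edge is counted twice: as \<open>f S\<close> avoids \<open>A\<close>, both
  \<open>S\<close> and the outer vertex can be read off from the intersection of the edge with
  \<open>A\<close>.\<close>

lemma card_M_hypergraph:
  assumes A: "card A = 4" and f: "\<And>S. S \<in> nsets A 2 \<Longrightarrow> finite (f S) \<and> f S \<inter> A = {}"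
  shows "card (M_hypergraph A f) = (\<Sum>S\<in>nsets A 2. card (f S))"
proof -
  have fin: "finite (nsets A 2)"
    using A card.infinite by (force intro!: finite_imp_finite_nsets)
  have inj: "inj_on (\<lambda>(S, x). insert x S) (Sigma (nsets A 2) f)"
  proof (rule inj_onI, clarify)
    fix S x T y
    assume S: "S \<in> nsets A 2" "x \<in> f S" and T: "T \<in> nsets A 2" "y \<in> f T"
      and eq: "insert x S = insert y T"
    have *: "S \<subseteq> A" "T \<subseteq> A" "x \<notin> A" "y \<notin> A" using S T f by (auto simp: nsets_def)
    then have "S = insert x S \<inter> A" "T = insert y T \<inter> A" by auto
    then have "S = T" using eq by simp
    then show "S = T \<and> x = y" using eq * by blast
  qed
  show ?thesis
    unfolding M_hypergraph_image card_image[OF inj] using fin f by (subst card_SigmaI) auto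
qed

lemma nsets_complement:
  assumes "card A = 4" "S \<in> nsets A 2"
  shows "A - S \<in> nsets A 2"
proof -
  have "finite A" using assms card.infinite by force
  then show ?thesis using assms by (auto simp: nsets_def card_Diff_subset)
qed

lemma card_pairs_quadruple: "card A = 4 \<Longrightarrow> card (nsets A 2) = 6"
  by (simp add: card_nsets choose_two[of 4, simplified])

lemma disjoint_pairs_complement:
  assumes A: "card A = 4" and S: "S \<in> nsets A 2" and T: "T \<in> nsets A 2" and "disjnt S T"
  shows "T = A - S"
proof (rule card_subset_eq)
  show "finite (A - S)" using A card.infinite by force
  show "T \<subseteq> A - S" using T assms(4) by (auto simp: nsets_def disjnt_iff)
  show "card T = card (A - S)" using nsets_complement[OF A S] T by (simp add: nsets_def)
qed

text \<open>Disjoint pairs in a 4-set are complementary, so an edge disjoint from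
  \<open>insert x S\<close> lies over \<open>A - S\<close>, and its outer vertex only has to differ
  from \<open>x\<close>.\<close>

lemma M_hypergraph_disjoint_edges:
  assumes A: "card A = 4" and f: "\<And>S. S \<in> nsets A 2 \<Longrightarrow> f S \<inter> A = {}"
    and S: "S \<in> nsets A 2" and x: "x \<in> f S"
  shows "{e \<in> M_hypergraph A f. disjnt (insert x S) e}
    = (\<lambda>y. insert y (A - S)) ` (f (A - S) - {x})" (is "?L = ?R")
proof
  show "?L \<subseteq> ?R"
  proof
    fix e assume "e \<in> ?L"
    then obtain T y where T: "T \<in> nsets A 2" "y \<in> f T" "e = insert y T"
        and dis: "disjnt (insert x S) e"
      unfolding mem_Collect_eq mem_M_hypergraph by blast
    then have "T = A - S" by (intro disjoint_pairs_complement[OF A S]) (auto simp: disjnt_iff)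
    then show "e \<in> ?R" using T dis by (auto simp: disjnt_iff)
  qed
  have "S \<subseteq> A" using S by (simp add: nsets_def)
  then show "?R \<subseteq> ?L"
    using f[OF S] f[OF nsets_complement[OF A S]] nsets_complement[OF A S] x
    by (auto simp: M_hypergraph_image disjnt_iff image_iff)
qed

lemma card_M_hypergraph_disjoint_edges:
  assumes A: "card A = 4" and f: "\<And>S. S \<in> nsets A 2 \<Longrightarrow> f S \<inter> A = {}"
    and S: "S \<in> nsets A 2" and x: "x \<in> f S"
  shows "card {e \<in> M_hypergraph A f. disjnt (insert x S) e} = card (f (A - S) - {x})"
proof -
  have "inj_on (\<lambda>y. insert y (A - S)) (f (A - S) - {x})"
    using f[OF nsets_complement[OF A S]] by (intro inj_onI) blast
  then show ?thesis
    using M_hypergraph_disjoint_edges[of A f S x] assms by (simp add: card_image)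
qed

section \<open>Structure of hypergraphs with at least \<open>6 * s + 6\<close> edges\<close>

context large_almost_intersecting_triples
begin

lemma M_hypergraph_form:
  obtains A B f where "M_data s A B f" "H = M_hypergraph A f"
proof -
  obtain A where A: "card A = 4"
    and heavy: "\<And>p. p \<in> nsets A 2 \<Longrightarrow> 91 * s \<le> 97 * card (star p) + 291"
    using heavy_quadruple by blast
  have finA: "finite A" using A card.infinite by force
  have meets: "2 \<le> card (e \<inter> A)" if "e \<in> H" for e
    using edge_meets_quadruple A heavy that by blast
  \<comment> \<open>Two disjoint edges each take at least two of the four vertices of
    \<open>A\<close>, hence exactly two; this also excludes edges inside \<open>A\<close>.\<close>
  have meet2: "card (e \<inter> A) = 2" if e: "e \<in> H" for e
  proof -
    obtain e' where e': "e' \<in> H" "disjnt e e'" using disjoint_edge_exists e by blast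
    have "card (e \<inter> A) + card (e' \<inter> A) = card ((e \<inter> A) \<union> (e' \<inter> A))"
      using finA e'(2) by (subst card_Un_disjoint) (auto simp: disjnt_iff)
    also have "\<dots> \<le> card A" using finA by (intro card_mono) auto
    finally show ?thesis using meets[OF e] meets[OF e'(1)] A by linarith
  qed
  define f where "f S = {x. x \<notin> A \<and> insert x S \<in> H}" for S
  have H_eq: "H = M_hypergraph A f"
  proof
    show "H \<subseteq> M_hypergraph A f"
    proof
      fix e assume e: "e \<in> H"
      have "card (e - A) = 1"
        using card_edge[OF e] meet2[OF e] finite_edge[OF e] card_Diff_subset_Int[of e A] by simp
      then obtain x where x: "e - A = {x}" by (auto simp: card_1_singleton_iff)
      then have "e = insert x (e \<inter> A)" "x \<notin> A" by auto
      moreover have "e \<inter> A \<in> nsets A 2" using finA meet2[OF e] by (auto simp: nsets_def)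
      ultimately show "e \<in> M_hypergraph A f" using e
        by (auto simp: M_hypergraph_def f_def intro!: exI[of _ "e \<inter> A"] exI[of _ x])
    qed
    show "M_hypergraph A f \<subseteq> H" by (auto simp: M_hypergraph_def f_def)
  qed
  have fA: "f S \<inter> A = {}" for S by (auto simp: f_def)
  have fin_f: "finite (f S)" for S
  proof (rule finite_subset)
    show "f S \<subseteq> \<Union>H" by (auto simp: f_def)
    show "finite (\<Union>H)" using finite_edge by auto
  qed
  have miss: "card (f (A - S) - {x}) \<le> s" if S: "S \<in> nsets A 2" and x: "x \<in> f S" for S x
  proof -
    have "insert x S \<in> H" using x by (simp add: f_def)
    from card_missing_edge_le[OF this] show ?thesis
      using card_M_hypergraph_disjoint_edges[of A f S x] A fA S x
      by (simp add: missing_def flip: H_eq)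
  qed
  \<comment> \<open>Some edge contains \<open>S\<close> because \<open>S\<close> has large degree,
    and its third vertex must lie outside \<open>A\<close>.\<close>
  have f_nonempty: "f S \<noteq> {}" if S: "S \<in> nsets A 2" for S
  proof -
    have "star S \<noteq> {}" using heavy[OF S] s_gt by auto
    then obtain e where e: "e \<in> H" "S \<subseteq> e" by (auto simp: star_def)
    have "S = e \<inter> A"
      using e S meet2[OF e(1)] finA by (intro card_subset_eq) (auto simp: nsets_def)
    moreover have "e - A \<noteq> {}"
      using meet2[OF e(1)] card_edge[OF e(1)] by (metis Diff_eq_empty_iff Int_absorb2 numeral_eq_iff
          semiring_norm(88,89))
    then obtain x where "x \<in> e" "x \<notin> A" by blast
    moreover have "card (insert x S) = card e"
      using \<open>x \<notin> A\<close> S card_edge[OF e(1)] by (auto simp: nsets_def card_insert_if)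
    then have "insert x S = e"
      using e \<open>x \<in> e\<close> finite_edge by (intro card_subset_eq) auto
    ultimately show ?thesis using e by (auto simp: f_def)
  qed
  have comp: "A - (A - S) = S" if "S \<in> nsets A 2" for S using that by (auto simp: nsets_def)
  \<comment> \<open>Any edge over \<open>A - S\<close> with outer vertex \<open>x\<close> is
    disjoint from all edges over \<open>S\<close> except possibly the one through \<open>x\<close>,
    whence \<open>s + 1\<close> rather than \<open>s\<close>.\<close>
  have f_le: "card (f S) \<le> s + 1" if S: "S \<in> nsets A 2" for S
  proof -
    have S': "A - S \<in> nsets A 2" using nsets_complement A S by blast
    obtain x where "x \<in> f (A - S)" using f_nonempty[OF S'] by blast
    then have "card (f S - {x}) \<le> s" using miss[OF S', of x] comp[OF S] by simp
    then show ?thesis by (simp add: card_Diff_singleton_if split: if_splits)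
  qed
  have total: "(\<Sum>S\<in>nsets A 2. card (f S)) \<ge> (\<Sum>S\<in>nsets A 2. s + 1)"
    using large card_M_hypergraph[of A f] A fin_f fA by (simp add: card_pairs_quadruple[OF A] del: card_nsets flip: H_eq)
  have fin2: "finite (nsets A 2)" using finA by (rule finite_imp_finite_nsets)
  \<comment> \<open>The six sets have size at most \<open>s + 1\<close> and total at least
    \<open>6 * (s + 1)\<close>, so equality holds throughout.\<close>
  have f_eq: "card (f S) = s + 1" if S: "S \<in> nsets A 2" for S
  proof (rule ccontr)
    assume "card (f S) \<noteq> s + 1"
    then have "(\<Sum>S\<in>nsets A 2. card (f S)) < (\<Sum>S\<in>nsets A 2. s + 1)"
      using f_le S fin2 by (intro sum_strict_mono_ex1) (auto simp: order.strict_iff_order)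
    then show False using total by simp
  qed
  \<comment> \<open>If \<open>x\<close> were not in \<open>f (A - S)\<close>, then
    \<open>insert x S\<close> would be disjoint from all \<open>s + 1\<close> edges over
    \<open>A - S\<close>.\<close>
  have f_sub: "f S \<subseteq> f (A - S)" if S: "S \<in> nsets A 2" for S
  proof
    fix x assume x: "x \<in> f S"
    show "x \<in> f (A - S)"
    proof (rule ccontr)
      assume "x \<notin> f (A - S)"
      then show False using miss[OF S x] f_eq[OF nsets_complement[OF A S]] by simp
    qed
  qed
  have "f S = f (A - S)" if S: "S \<in> nsets A 2" for S
    using f_sub[OF S] f_sub[OF nsets_complement[OF A S]] comp[OF S] by auto
  \<comment> \<open>The whole complement of \<open>A\<close> serves as \<open>B\<close>; if finite,
    it contains some \<open>f S\<close> of size \<open>s + 1\<close>.\<close>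
  moreover have "infinite (- A) \<or> s + 1 \<le> card (- A)"
  proof -
    have "nsets A 2 \<noteq> {}" using card_pairs_quadruple[OF A] by (metis card.empty zero_neq_numeral)
    then obtain S where "S \<in> nsets A 2" by blast
    then show ?thesis using f_eq[of S] card_mono[of "- A" "f S"] fA by fastforce
  qed
  ultimately have "M_data s A (- A) f"
    using A f_eq fin_f fA by (auto simp: M_data_def nsets_def disjnt_iff f_def)
  then show thesis using H_eq that by blast
qed

end

section \<open>The hypergraphs from \<open>M_data\<close> attain the bound\<close>

lemma M_dataD:
  assumes "M_data s A B f" and S: "S \<in> nsets A 2"
  shows "finite (f S) \<and> f S \<inter> A = {}" "card (f S) = s + 1" "f (A - S) = f S"
proof -
  have "f S \<in> nsets B (s + 1)" "disjnt A B"
    using assms unfolding M_data_def by blast+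
  then show "finite (f S) \<and> f S \<inter> A = {}" "card (f S) = s + 1"
    by (auto simp: nsets_def disjnt_iff)
  show "f (A - S) = f S" using assms by (simp add: M_data_def)
qed

lemma M_data_card:
  assumes "M_data s A B f"
  shows "card (M_hypergraph A f) = 6 * s + 6"
proof -
  have A: "card A = 4" using assms by (simp add: M_data_def)
  have "card (M_hypergraph A f) = (\<Sum>S\<in>nsets A 2. card (f S))"
    using card_M_hypergraph A M_dataD(1)[OF assms] by blast
  also have "\<dots> = (\<Sum>S\<in>nsets A 2. s + 1)"
    using M_dataD(2)[OF assms] by (rule sum.cong[OF refl])
  finally have "card (M_hypergraph A f) = (\<Sum>S\<in>nsets A 2. s + 1)" .
  then show ?thesis by (simp add: card_pairs_quadruple[OF A] del: card_nsets)
qed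

text \<open>Every edge \<open>insert x S\<close> is disjoint from exactly \<open>s\<close> edges:
  \<open>f (A - S) = f S\<close> has \<open>s + 1\<close> elements, one of which is
  \<open>x\<close>.\<close>

lemma M_data_almost_intersecting:
  assumes M: "M_data s A B f" and s: "1 \<le> s"
  shows "uniform_hypergraph 3 (M_hypergraph A f) \<and> almost_intersecting 1 s (M_hypergraph A f)"
proof -
  have A: "card A = 4" using M by (simp add: M_data_def)
  note f = M_dataD[OF M]
  \<comment> \<open>An infinite set would have \<open>card\<close> 0, but the count is
    \<open>6 * s + 6\<close>.\<close>
  have "finite (M_hypergraph A f)"
    by (rule card_ge_0_finite) (simp add: M_data_card[OF M])
  moreover have "e \<in> nsets UNIV 3" if e: "e \<in> M_hypergraph A f" for e
  proof -
    obtain S x where "S \<in> nsets A 2" "x \<in> f S" "e = insert x S"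
      using e unfolding mem_M_hypergraph by blast
    moreover from this have "x \<notin> S" using f(1)[of S] by (auto simp: nsets_def)
    ultimately show ?thesis by (auto simp: nsets_def)
  qed
  moreover have "card {e' \<in> M_hypergraph A f. disjnt e e'} = s" if e: "e \<in> M_hypergraph A f" for e
  proof -
    obtain S x where S: "S \<in> nsets A 2" "x \<in> f S" "e = insert x S"
      using e unfolding mem_M_hypergraph by blast
    have "card {e' \<in> M_hypergraph A f. disjnt (insert x S) e'} = card (f (A - S) - {x})"
      by (rule card_M_hypergraph_disjoint_edges) (use A f(1) S in auto)
    then show ?thesis using f[OF S(1)] S by simp
  qed
  ultimately show ?thesis
    using s by (auto simp: uniform_hypergraph_def almost_intersecting_def)
qed

theorem theorem4p3:
  fixes s :: nat
  assumes "s > 625"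
  shows "(\<forall>H :: 'a set set.
            uniform_hypergraph 3 H \<and> almost_intersecting 1 s H \<longrightarrow> card H \<le> 6 * s + 6) \<and>
         (\<forall>H :: 'a set set.
            uniform_hypergraph 3 H \<and> almost_intersecting 1 s H \<and> card H = 6 * s + 6 \<longleftrightarrow>
            (\<exists>A B f. M_data s A B f \<and> H = M_hypergraph A f))"
proof -
  \<comment> \<open>Assuming only a lower bound on \<open>card H\<close> settles both claims: the
    structure found forces exactly \<open>6 * s + 6\<close> edges, so no larger hypergraph
    exists.\<close>
  have large: "\<exists>A B f. M_data s A B f \<and> H = M_hypergraph A f"
    if "uniform_hypergraph 3 H" "almost_intersecting 1 s H" "6 * s + 6 \<le> card H"
    for H :: "'a set set"
  proof -
    interpret large_almost_intersecting_triples H s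
      using that assms by unfold_locales auto
    show ?thesis using M_hypergraph_form by metis
  qed
  have "card H \<le> 6 * s + 6"
    if "uniform_hypergraph 3 H" "almost_intersecting 1 s H" for H :: "'a set set"
    using large[OF that] M_data_card nat_le_linear by metis
  moreover have "uniform_hypergraph 3 H \<and> almost_intersecting 1 s H \<and> card H = 6 * s + 6"
    if "M_data s A B f" "H = M_hypergraph A f" for H :: "'a set set" and A B f
    using M_data_almost_intersecting[OF that(1)] M_data_card[OF that(1)] that(2) assms by simp
  ultimately show ?thesis using large by (intro conjI allI impI iffI; elim conjE exE; simp)
qed

end
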